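(* Let $X,Y$ be circularly ordered sets. (1) Let $p:X\to Y$ be a map satisfying condition (COP1), and suppose that $p(X)$ is not a two-point set. Then $p$ is COP. (2) Let $p:X\to Y$ be a COP map. Then: (a) If $p(a)\neq p(b)$ then $p([a,b])=[p(a),p(b)]\cap p(X)$. Moreover, the image $p(C)$ is convex in $p(X)$ for every convex $C\subseteq X$. (b) The preimage $p^{-1}(I)$ is convex in $X$ for every convex subset $I$ of $Y$. (c) For every $z\in X$ the restricted map $(X\setminus p^{-1}(p(z)),\leq_z)\to(Y,\leq_{p(z)})$ is linear order preserving.
   Context: A circular order on a set $X$ is a ternary relation $R\subseteq X^3$ (write $[a,b,c]$ for $(a,b,c)\in R$) satisfying: cyclicity ($[a,b,c]\Rightarrow[b,c,a]$); asymmetry ($[a,b,c]\Rightarrow (c,b,a)\notin R$); transitivity ($[a,b,c]$ and $[a,c,d]$ imply $[a,b,d]$); totality (if $a,b,c$ are distinct then $[a,b,c]$ or $[a,c,b]$). Put $(a,b):=\{x\in X:[a,x,b]\}$ and $[a,b]:=(a,b)\cup\{a,b\}$ (so $[a,a]=\{a\}$). Subsets carry the induced circular order. A map $f:X_1\to X_2$ of circularly ordered sets is COP (circular order preserving) if: (COP1) whenever $[a,b,c]$ in $X_1$ and $f(a),f(b),f(c)$ are pairwise distinct, then $[f(a),f(b),f(c)]$ in $X_2$; (COP2) if $f(x)=f(y)$ then $f$ is constant on one of the closed intervals $[x,y]$, $[y,x]$. A subset $C$ of a circularly ordered set $X$ is convex in $X$ if for all $a,b\in C$ at least one of the intervals $[a,b]$,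 $[b,a]$ (computed in $X$) is contained in $C$. For $z\in X$ the standard cut $\leq_z$ is the linear order on $X$ with least element $z$ and with $a<_z b\iff[z,a,b]$ for $a,b\in X\setminus\{z\}$. A map $f$ between linearly ordered sets is linear order preserving if $x\leq x'$ implies $f(x)\leq f(x')$. *)

theory Defs
  imports Main "HOL-Library.FuncSet"
begin

definition circular_order_on :: "'a set \<Rightarrow> ('a \<times> 'a \<times> 'a) set \<Rightarrow> bool" where
  "circular_order_on X R \<longleftrightarrow>
     R \<subseteq> X \<times> X \<times> X \<and>
     (\<forall>a b c. (a, b, c) \<in> R \<longrightarrow> (b, c, a) \<in> R) \<and>
     (\<forall>a b c. (a, b, c) \<in> R \<longrightarrow> (c, b, a) \<notin> R) \<and>
     (\<forall>a b c d. (a, b, c) \<in> R \<and> (a, c, d) \<in> R \<longrightarrow> (a, b, d) \<in> R) \<and>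
     (\<forall>a\<in>X. \<forall>b\<in>X. \<forall>c\<in>X. a \<noteq> b \<and> b \<noteq> c \<and> a \<noteq> c \<longrightarrow> (a, b, c) \<in> R \<or> (a, c, b) \<in> R)"

definition open_arc :: "('a \<times> 'a \<times> 'a) set \<Rightarrow> 'a \<Rightarrow> 'a \<Rightarrow> 'a set" where
  "open_arc R a b = {x. (a, x, b) \<in> R}"

definition closed_arc :: "('a \<times> 'a \<times> 'a) set \<Rightarrow> 'a \<Rightarrow> 'a \<Rightarrow> 'a set" where
  "closed_arc R a b = open_arc R a b \<union> {a, b}"

definition induced_order :: "('a \<times> 'a \<times> 'a) set \<Rightarrow> 'a set \<Rightarrow> ('a \<times> 'a \<times> 'a) set" where
  "induced_order R A = R \<inter> A \<times> A \<times> A"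

definition convex_in :: "'a set \<Rightarrow> ('a \<times> 'a \<times> 'a) set \<Rightarrow> 'a set \<Rightarrow> bool" where
  "convex_in X R C \<longleftrightarrow>
     C \<subseteq> X \<and> (\<forall>a\<in>C. \<forall>b\<in>C. closed_arc R a b \<subseteq> C \<or> closed_arc R b a \<subseteq> C)"

text \<open>
  No carrier is needed in \<open>COP1\<close>: a circular order on \<open>X\<close> relates elements of \<open>X\<close> only.
\<close>

definition COP1 :: "('a \<times> 'a \<times> 'a) set \<Rightarrow> ('b \<times> 'b \<times> 'b) set \<Rightarrow> ('a \<Rightarrow> 'b) \<Rightarrow> bool" where
  "COP1 R S f \<longleftrightarrow>
     (\<forall>a b c. (a, b, c) \<in> R \<and> f a \<noteq> f b \<and> f b \<noteq> f c \<and> f a \<noteq> f c \<longrightarrow> (f a, f b, f c) \<in> S)"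

definition COP2 :: "'a set \<Rightarrow> ('a \<times> 'a \<times> 'a) set \<Rightarrow> ('a \<Rightarrow> 'b) \<Rightarrow> bool" where
  "COP2 X R f \<longleftrightarrow>
     (\<forall>x\<in>X. \<forall>y\<in>X. f x = f y \<longrightarrow>
        (\<exists>c. \<forall>u\<in>closed_arc R x y. f u = c) \<or> (\<exists>c. \<forall>u\<in>closed_arc R y x. f u = c))"

definition COP :: "'a set \<Rightarrow> ('a \<times> 'a \<times> 'a) set \<Rightarrow> 'b set \<Rightarrow> ('b \<times> 'b \<times> 'b) set \<Rightarrow> ('a \<Rightarrow> 'b) \<Rightarrow> bool"
  where "COP X R Y S f \<longleftrightarrow> f \<in> X \<rightarrow> Y \<and> COP1 R S f \<and> COP2 X R f"

definition standard_cut :: "'a set \<Rightarrow> ('a \<times> 'a \<times> 'a) set \<Rightarrow> 'a \<Rightarrow> ('a \<times> 'a) set" where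
  "standard_cut X R z = {(a, b). a \<in> X \<and> b \<in> X \<and> (a = b \<or> a = z \<or> (z, a, b) \<in> R)}"

lemma circular_order_onD:
  assumes "circular_order_on X R"
  shows "(a, b, c) \<in> R \<Longrightarrow> (b, c, a) \<in> R"
    and "(a, b, c) \<in> R \<Longrightarrow> (c, b, a) \<notin> R"
    and "(a, b, c) \<in> R \<Longrightarrow> (a, c, d) \<in> R \<Longrightarrow> (a, b, d) \<in> R"
    and "a \<in> X \<Longrightarrow> b \<in> X \<Longrightarrow> c \<in> X \<Longrightarrow> a \<noteq> b \<Longrightarrow> b \<noteq> c \<Longrightarrow> a \<noteq> c \<Longrightarrow>
      (a, b, c) \<in> R \<or> (a, c, b) \<in> R"
proof -
  from assms have 1: "\<forall>a b c. (a, b, c) \<in> R \<longrightarrow> (b, c, a) \<in> R"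
    and 2: "\<forall>a b c. (a, b, c) \<in> R \<longrightarrow> (c, b, a) \<notin> R"
    and 3: "\<forall>a b c d. (a, b, c) \<in> R \<and> (a, c, d) \<in> R \<longrightarrow> (a, b, d) \<in> R"
    and 4: "\<forall>a\<in>X. \<forall>b\<in>X. \<forall>c\<in>X. a \<noteq> b \<and> b \<noteq> c \<and> a \<noteq> c \<longrightarrow>
      (a, b, c) \<in> R \<or> (a, c, b) \<in> R"
    unfolding circular_order_on_def by iprover+
  show "(a, b, c) \<in> R \<Longrightarrow> (b, c, a) \<in> R" using 1 by iprover
  show "(a, b, c) \<in> R \<Longrightarrow> (c, b, a) \<notin> R" using 2 by iprover
  show "(a, b, c) \<in> R \<Longrightarrow> (a, c, d) \<in> R \<Longrightarrow> (a, b, d) \<in> R" using 3 by iprover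
  show "a \<in> X \<Longrightarrow> b \<in> X \<Longrightarrow> c \<in> X \<Longrightarrow> a \<noteq> b \<Longrightarrow> b \<noteq> c \<Longrightarrow> a \<noteq> c \<Longrightarrow>
      (a, b, c) \<in> R \<or> (a, c, b) \<in> R" using 4 by simp
qed

lemma circular_order_distinct:
  assumes "circular_order_on X R" "(a, b, c) \<in> R"
  shows "a \<noteq> b" "b \<noteq> c" "a \<noteq> c"
  using circular_order_onD(1,2)[OF assms(1)] assms(2) by metis+

lemma circular_order_on_induced:
  assumes "circular_order_on X R" "A \<subseteq> X"
  shows "circular_order_on A (induced_order R A)"
  unfolding circular_order_on_def
proof (intro conjI allI ballI impI)
  note D = circular_order_onD[OF assms(1)]
  show "induced_order R A \<subseteq> A \<times> A \<times> A"
    by (simp add: induced_order_def)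
  show "(b, c, a) \<in> induced_order R A" if "(a, b, c) \<in> induced_order R A" for a b c
    using that D(1)[of a b c] by (simp add: induced_order_def)
  show "(c, b, a) \<notin> induced_order R A" if "(a, b, c) \<in> induced_order R A" for a b c
    using that D(2)[of a b c] by (simp add: induced_order_def)
  show "(a, b, d) \<in> induced_order R A"
    if "(a, b, c) \<in> induced_order R A \<and> (a, c, d) \<in> induced_order R A" for a b c d
    using that D(3)[of a b c d] by (simp add: induced_order_def)
  show "(a, b, c) \<in> induced_order R A \<or> (a, c, b) \<in> induced_order R A"
    if "a \<in> A" "b \<in> A" "c \<in> A" "a \<noteq> b \<and> b \<noteq> c \<and> a \<noteq> c" for a b c
    using that D(4)[of a b c] assms(2) by (simp add: induced_order_def subset_iff)
qed

lemma linear_order_standard_cut: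
  assumes "circular_order_on X R" "z \<in> X"
  shows "linear_order_on X (standard_cut X R z)"
proof -
  note D = circular_order_onD[OF assms(1)]
  note d = circular_order_distinct[OF assms(1)]
  have "trans (standard_cut X R z)"
  proof (rule transI)
    fix a b c
    assume "(a, b) \<in> standard_cut X R z" "(b, c) \<in> standard_cut X R z"
    then show "(a, c) \<in> standard_cut X R z"
      using D(3)[of z a b c] d(1)[of z b] d(1)[of z a b] d(3)[of z a z] d(2)[of z a b] d(3)[of z a b]
      by (simp add: standard_cut_def) metis
  qed
  moreover have "antisym (standard_cut X R z)"
  proof (rule antisymI)
    fix a b
    assume "(a, b) \<in> standard_cut X R z" "(b, a) \<in> standard_cut X R z"
    then show "a = b"
      using D(1)[of z a b] D(2)[of a b z] d(3)[of z a b] d(3)[of z b a]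
      by (simp add: standard_cut_def) metis
  qed
  moreover have "total_on X (standard_cut X R z)"
  proof (rule total_onI)
    fix a b
    assume "a \<in> X" "b \<in> X" "a \<noteq> b"
    then show "(a, b) \<in> standard_cut X R z \<or> (b, a) \<in> standard_cut X R z"
      using D(4)[of z a b] assms(2) by (simp add: standard_cut_def) metis
  qed
  moreover have "refl_on X (standard_cut X R z)" "standard_cut X R z \<subseteq> X \<times> X"
    by (simp_all add: refl_on_def standard_cut_def subset_iff)
  ultimately show ?thesis
    by (simp add: linear_order_on_def partial_order_on_def preorder_on_def)
qed

lemma standard_cut_least:
  assumes "z \<in> X" "a \<in> X"
  shows "(z, a) \<in> standard_cut X R z"
  using assms by (simp add: standard_cut_def)

lemma standard_cut_strict:
  assumes "circular_order_on X R" "a \<in> X - {z}" "b \<in> X - {z}"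
  shows "(a, b) \<in> standard_cut X R z \<and> a \<noteq> b \<longleftrightarrow> (z, a, b) \<in> R"
  using assms(2,3) circular_order_distinct(2)[OF assms(1), of z a b]
  by (simp add: standard_cut_def) metis

end

theory Submission
  imports Defs
begin

text \<open>
  For (1), if \<open>p x = p y\<close> and both arcs between \<open>x\<close> and \<open>y\<close> contained a point not sent to
  \<open>p x\<close>, then a third value of \<open>p\<close> allows one to choose such points \<open>u\<close>, \<open>v\<close> in the two arcs
  with \<open>p u \<noteq> p v\<close>; COP1 applied to \<open>[x, u, v]\<close> and \<open>[y, v, u]\<close> then orients the same three
  values in both ways.  The image formula in (2)(a) holds because a point whose image lies
  strictly between \<open>p a\<close> and \<open>p b\<close> cannot lie in the opposite arc \<open>(b, a)\<close>; the convexity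
  statements reduce to it, COP2 covering the case of equal end values.
\<close>

lemma circular_order_subset:
  assumes "circular_order_on X R" and "(a, b, c) \<in> R"
  shows "a \<in> X" "b \<in> X" "c \<in> X"
proof -
  have "R \<subseteq> X \<times> X \<times> X"
    using assms(1) unfolding circular_order_on_def by (rule conjunct1)
  with assms(2) show "a \<in> X" "b \<in> X" "c \<in> X"
    by auto
qed

lemma circular_order_swap:
  assumes "circular_order_on X R" and "(a, b, c) \<in> R"
  shows "(a, c, b) \<notin> R"
proof
  assume "(a, c, b) \<in> R"
  then have "(c, b, a) \<in> R"
    by (rule circular_order_onD(1)[OF assms(1)])
  then show False
    using circular_order_onD(2)[OF assms] by contradiction
qed

lemma COP1D:
  assumes "COP1 R S f" and "(a, b, c) \<in> R" and "f a \<noteq> f b" "f b \<noteq> f c" "f a \<noteq> f c"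
  shows "(f a, f b, f c) \<in> S"
  using assms by (simp add: COP1_def)

lemma closed_arc_subset:
  assumes "circular_order_on X R" "a \<in> X" "b \<in> X"
  shows "closed_arc R a b \<subseteq> X"
  using assms(2,3) circular_order_subset(2)[OF assms(1)]
  by (auto simp: closed_arc_def open_arc_def)

lemma closed_arc_same:
  assumes "circular_order_on X R"
  shows "closed_arc R a a = {a}"
  using circular_order_distinct(3)[OF assms] by (auto simp: closed_arc_def open_arc_def)

lemma closed_arc_induced:
  assumes "a \<in> A" "b \<in> A"
  shows "closed_arc (induced_order R A) a b = closed_arc R a b \<inter> A"
  using assms by (auto simp: closed_arc_def open_arc_def induced_order_def)

text \<open>If the endpoints share a value, a second value on one arc and a different one on the
  other would fix two conflicting orientations of the same triple. So a violation of COP2 leaves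
  only one further value.\<close>

lemma COP1_opposite_arcs:
  assumes R: "circular_order_on X R" and S: "circular_order_on Y S" and "COP1 R S p"
    and u: "(x, u, y) \<in> R" and v: "(y, v, x) \<in> R"
    and "p x = p y" and "p u \<noteq> p x" and "p v \<noteq> p x"
  shows "p u = p v"
proof (rule ccontr)
  assume ne: "p u \<noteq> p v"
  note C = circular_order_onD(1)[OF R] and T = circular_order_onD(3)[OF R]
  \<comment> \<open>Rotating \<open>v\<close> to \<open>(x, y, v)\<close> gives both triples the
    base point \<open>x\<close>, as transitivity requires.\<close>
  have "(x, u, v) \<in> R"
    by (rule T[OF u C[OF C[OF v]]])
  then have "(p x, p u, p v) \<in> S"
    using COP1D[OF assms(3), of x u v] assms(6-8) ne by simp
  moreover have "(y, v, u) \<in> R"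
    by (rule T[OF v C[OF C[OF u]]])
  then have "(p x, p v, p u) \<in> S"
    using COP1D[OF assms(3), of y v u] assms(6-8) ne by simp
  ultimately show False
    using circular_order_swap[OF S] by blast
qed

lemma COP1_imp_COP2:
  assumes R: "circular_order_on X R" and S: "circular_order_on Y S" and p: "COP1 R S p"
    and card: "card (p ` X) \<noteq> 2"
  shows "COP2 X R p"
  unfolding COP2_def
proof (intro ballI impI, rule ccontr)
  fix x y
  assume x: "x \<in> X" and y: "y \<in> X" and eq: "p x = p y"
    and nc: "\<not> ((\<exists>c. \<forall>u\<in>closed_arc R x y. p u = c) \<or> (\<exists>c. \<forall>u\<in>closed_arc R y x. p u = c))"
  \<comment> \<open>Take \<open>c = p x\<close> in both negated disjuncts. As
    \<open>p x = p y\<close>, the witnesses are not endpoints and so lie in the open arcs.\<close>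
  from nc obtain u v where "u \<in> closed_arc R x y" "p u \<noteq> p x" "v \<in> closed_arc R y x" "p v \<noteq> p x"
    by metis
  with eq have u: "(x, u, y) \<in> R" "p u \<noteq> p x" and v: "(y, v, x) \<in> R" "p v \<noteq> p x"
    by (auto simp: closed_arc_def open_arc_def)
  note opp = COP1_opposite_arcs[OF R S p _ _ eq]
  have uv: "p u = p v"
    by (rule opp) (use u v in auto)
  have "p ` X \<noteq> {p x, p u}"
    using card u(2) by (auto simp: card_insert_if)
  moreover have "{p x, p u} \<subseteq> p ` X"
    using x circular_order_subset(2)[OF R u(1)] by blast
  ultimately obtain w where w: "w \<in> X" "p w \<noteq> p x" "p w \<noteq> p u"
    by blast
  have "x \<noteq> y"
    using circular_order_distinct(3)[OF R u(1)] .
  \<comment> \<open>Whichever open arc contains \<open>w\<close>, pairing it with \<open>v\<close>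
    or \<open>u\<close> from the opposite arc forces \<open>p w = p u\<close>.\<close>
  then have "(x, w, y) \<in> R \<or> (x, y, w) \<in> R"
    using circular_order_onD(4)[OF R x w(1) y] w eq by auto
  then show False
  proof
    assume "(x, w, y) \<in> R"
    then show False
      using opp[of w v] v w uv by simp
  next
    assume "(x, y, w) \<in> R"
    then have "(y, w, x) \<in> R"
      by (rule circular_order_onD(1)[OF R])
    then show False
      using opp[of u w] u w by simp
  qed
qed

lemma COP1_image_closed_arc:
  assumes R: "circular_order_on X R" and S: "circular_order_on Y S" and p: "COP1 R S p"
    and a: "a \<in> X" and b: "b \<in> X" and ne: "p a \<noteq> p b"
  shows "p ` closed_arc R a b = closed_arc S (p a) (p b) \<inter> p ` X"
proof
  show "p ` closed_arc R a b \<subseteq> closed_arc S (p a) (p b) \<inter> p ` X"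
  proof
    fix w assume "w \<in> p ` closed_arc R a b"
    then obtain x where x: "x \<in> closed_arc R a b" "w = p x" by blast
    have "w \<in> closed_arc S (p a) (p b)"
      using x ne COP1D[OF p, of a x b]
      by (cases "p x = p a"; cases "p x = p b") (auto simp: closed_arc_def open_arc_def)
    with x closed_arc_subset[OF R a b] show "w \<in> closed_arc S (p a) (p b) \<inter> p ` X"
      by blast
  qed
  show "closed_arc S (p a) (p b) \<inter> p ` X \<subseteq> p ` closed_arc R a b"
  proof
    fix w assume "w \<in> closed_arc S (p a) (p b) \<inter> p ` X"
    then obtain x where x: "x \<in> X" "w = p x" "p x \<in> closed_arc S (p a) (p b)" by blast
    show "w \<in> p ` closed_arc R a b"
    proof (cases "p x = p a \<or> p x = p b")
      case True
      \<comment> \<open>Here \<open>x\<close> itself may lie outside the arc; the value is attained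
        at \<open>a\<close> or \<open>b\<close> instead.\<close>
      then show ?thesis using x by (auto simp: closed_arc_def)
    next
      case False
      with x have between: "(p a, p x, p b) \<in> S"
        by (simp add: closed_arc_def open_arc_def)
      have "(a, b, x) \<notin> R"
      proof
        assume "(a, b, x) \<in> R"
        then have "(p a, p b, p x) \<in> S"
          using COP1D[OF p, of a b x] ne False by auto
        then show False
          using between circular_order_swap[OF S] by blast
      qed
      then have "(a, x, b) \<in> R"
        using circular_order_onD(4)[OF R a x(1) b] ne False by auto
      then show ?thesis using x by (simp add: closed_arc_def open_arc_def)
    qed
  qed
qed

lemma COP1_convex_image:
  assumes R: "circular_order_on X R" and S: "circular_order_on Y S" and p: "COP1 R S p"
    and C: "convex_in X R C"
  shows "convex_in (p ` X) (induced_order S (p ` X)) (p ` C)"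
proof -
  have CX: "C \<subseteq> X"
    using C by (simp add: convex_in_def)
  let ?arc = "closed_arc (induced_order S (p ` X))"
  have "?arc (p a) (p b) \<subseteq> p ` C \<or> ?arc (p b) (p a) \<subseteq> p ` C" if ab: "a \<in> C" "b \<in> C" for a b
  proof -
    have X: "a \<in> X" "b \<in> X" using ab CX by auto
    then have arc: "?arc (p a) (p b) = closed_arc S (p a) (p b) \<inter> p ` X"
      "?arc (p b) (p a) = closed_arc S (p b) (p a) \<inter> p ` X"
      by (simp_all add: closed_arc_induced)
    show ?thesis
    proof (cases "p a = p b")
      case True
      then show ?thesis using arc closed_arc_same[OF S] ab by auto
    next
      case False
      then have "?arc (p a) (p b) = p ` closed_arc R a b" "?arc (p b) (p a) = p ` closed_arc R b a"
        using arc COP1_image_closed_arc[OF R S p] X by auto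
      moreover have "closed_arc R a b \<subseteq> C \<or> closed_arc R b a \<subseteq> C"
        using C ab by (simp add: convex_in_def)
      ultimately show ?thesis by (metis image_mono)
    qed
  qed
  with CX show ?thesis
    unfolding convex_in_def by blast
qed

lemma COP_convex_vimage:
  assumes R: "circular_order_on X R" and S: "circular_order_on Y S" and p: "COP X R Y S p"
    and I: "convex_in Y S I"
  shows "convex_in X R (p -` I \<inter> X)"
proof -
  have p1: "COP1 R S p" and p2: "COP2 X R p"
    using p by (simp_all add: COP_def)
  have "closed_arc R a b \<subseteq> p -` I \<inter> X \<or> closed_arc R b a \<subseteq> p -` I \<inter> X"
    if X: "a \<in> X" "b \<in> X" and ab: "p a \<in> I" "p b \<in> I" for a b
  proof -
    have "p ` closed_arc R a b \<subseteq> I \<or> p ` closed_arc R b a \<subseteq> I"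
    proof (cases "p a = p b")
      case True
      then obtain c where "(\<forall>u\<in>closed_arc R a b. p u = c) \<or> (\<forall>u\<in>closed_arc R b a. p u = c)"
        using p2 X unfolding COP2_def by metis
      \<comment> \<open>This identifies the constant \<open>c\<close> as \<open>p a\<close>, which
        lies in \<open>I\<close>.\<close>
      moreover have "a \<in> closed_arc R a b" "a \<in> closed_arc R b a"
        by (simp_all add: closed_arc_def)
      ultimately show ?thesis using ab(1) by (metis image_subsetI)
    next
      case False
      have "closed_arc S (p a) (p b) \<subseteq> I \<or> closed_arc S (p b) (p a) \<subseteq> I"
        using I ab by (simp add: convex_in_def)
      then show ?thesis
        using COP1_image_closed_arc[OF R S p1 X False]
          COP1_image_closed_arc[OF R S p1 X(2,1) False[symmetric]] by blast
    qed
    then show ?thesis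
      using closed_arc_subset[OF R X] closed_arc_subset[OF R X(2,1)] by blast
  qed
  then show ?thesis
    unfolding convex_in_def by blast
qed

text \<open>Off the fibre of \<open>p z\<close>, the images of \<open>z, a, b\<close> can coincide
  only through \<open>p a = p b\<close>, which reflexivity of the target cut absorbs.\<close>

lemma COP1_monotone_standard_cut:
  assumes "p \<in> X \<rightarrow> Y" and "COP1 R S p"
  shows "monotone_on (X - p -` {p z})
    (\<lambda>x x'. (x, x') \<in> standard_cut X R z)
    (\<lambda>y y'. (y, y') \<in> standard_cut Y S (p z)) p"
proof (rule monotone_onI)
  fix a b
  assume ab: "a \<in> X - p -` {p z}" "b \<in> X - p -` {p z}" "(a, b) \<in> standard_cut X R z"
  \<comment> \<open>The case \<open>a = z\<close> of the cut is excluded because \<open>z\<close>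
    lies in the removed fibre.\<close>
  then have "p a = p b \<or> (z, a, b) \<in> R"
    by (auto simp: standard_cut_def)
  then have "p a = p b \<or> (p z, p a, p b) \<in> S"
    using COP1D[OF assms(2), of z a b] ab(1,2) by (cases "p a = p b") auto
  then show "(p a, p b) \<in> standard_cut Y S (p z)"
    using assms(1) ab(1,2) by (auto simp: standard_cut_def)
qed

theorem proposition4p4:
  fixes X :: "'a set" and R :: "('a \<times> 'a \<times> 'a) set"
    and Y :: "'b set" and S :: "('b \<times> 'b \<times> 'b) set"
  assumes "circular_order_on X R" and "circular_order_on Y S"
  shows "(\<forall>p. p \<in> X \<rightarrow> Y \<and> COP1 R S p \<and> card (p ` X) \<noteq> 2 \<longrightarrow> COP X R Y S p) \<and>
    (\<forall>p. COP X R Y S p \<longrightarrow>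
      ((\<forall>a\<in>X. \<forall>b\<in>X. p a \<noteq> p b \<longrightarrow>
          p ` closed_arc R a b = closed_arc S (p a) (p b) \<inter> p ` X) \<and>
       (\<forall>C. convex_in X R C \<longrightarrow> convex_in (p ` X) (induced_order S (p ` X)) (p ` C))) \<and>
      (\<forall>I. convex_in Y S I \<longrightarrow> convex_in X R (p -` I \<inter> X)) \<and>
      (\<forall>z\<in>X. monotone_on (X - p -` {p z})
          (\<lambda>x x'. (x, x') \<in> standard_cut X R z)
          (\<lambda>y y'. (y, y') \<in> standard_cut Y S (p z)) p))"
proof (intro conjI allI impI ballI)
  note R = assms(1) and S = assms(2)
  show "COP X R Y S p" if "p \<in> X \<rightarrow> Y \<and> COP1 R S p \<and> card (p ` X) \<noteq> 2" for p
    using that COP1_imp_COP2[OF R S] by (simp add: COP_def)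
  fix p
  assume p: "COP X R Y S p"
  then have pXY: "p \<in> X \<rightarrow> Y" and p1: "COP1 R S p"
    by (simp_all add: COP_def)
  show "p ` closed_arc R a b = closed_arc S (p a) (p b) \<inter> p ` X"
    if "a \<in> X" "b \<in> X" "p a \<noteq> p b" for a b
    using COP1_image_closed_arc[OF R S p1 that] .
  show "convex_in (p ` X) (induced_order S (p ` X)) (p ` C)" if "convex_in X R C" for C
    using COP1_convex_image[OF R S p1 that] .
  show "convex_in X R (p -` I \<inter> X)" if "convex_in Y S I" for I
    using COP_convex_vimage[OF R S p that] .
  show "monotone_on (X - p -` {p z})
      (\<lambda>x x'. (x, x') \<in> standard_cut X R z)
      (\<lambda>y y'. (y, y') \<in> standard_cut Y S (p z)) p" for z
    using COP1_monotone_standard_cut[OF pXY p1] .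
qed

end
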